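(* Let $\mathbf{u}:I\to\mathbf{B}^{\mathrm{div}}_k$ be a differentiable function of time on an interval $I$ that solves the semi-discrete discontinuous Galerkin scheme: for all $t\in I$ and all $\mathbf{v}\in\mathbf{B}^{\mathrm{div}}_k$, $$\sum_{C\in\mathcal{C}}\int_C\mathbf{v}\cdot\partial_t\mathbf{u}-\sum_{C\in\mathcal{C}}\int_C g\,\nabla\cdot\mathbf{v}+\sum_{S\in\mathcal{S}}\int_S[\mathbf{v}]_S\cdot\widetilde{\mathbf{G}}=0,$$ where $g$ is a scalar function on the cells (which may depend nonlinearly on the unknowns of the system) and $\widetilde{\mathbf{G}}$ is the vector-valued numerical flux on the sides. If $\widetilde{\mathbf{G}}$ is parallel to $\mathbf{n}_S$ on every side $S\in\mathcal{S}$, then $$\partial_t\big((\nabla^{\perp})^{\star}\mathbf{u}\big)=0 .$$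
   Context: Notation: $\nabla=(\partial_x,\partial_y)$, $\nabla^{\perp}=(-\partial_y,\partial_x)$. Mesh. $\Omega=\mathbb{T}^2$ is the flat two-dimensional torus, partitioned by a conforming mesh into a finite set $\mathcal{C}$ of straight-sided cells, either all triangles or all quadrangles. $\mathcal{S}$ is the set of sides. Each side $S$ is oriented once for all with unit normal $\mathbf{n}_S$; its left cell $L$ is the neighbouring cell for which $\mathbf{n}_S$ is outgoing, its right cell $R$ the one for which $\mathbf{n}_S$ is ingoing. The jump of a cellwise continuous (scalar or vector) function $f$ is $[f]_S=f_L-f_R$. Spaces ($k\ge0$ an integer). $\mathbb{P}_m$: polynomials of total degree $\le m$; $\mathbb{Q}_{i,j}$: polynomials of degree $\le i$ in $x$ and $\le j$ in $y$; $\mathbb{Q}_m=\mathbb{Q}_{m,m}$; spaces with a negative index are $\{0\}$. $\mathbb{A}_{k+1}$ is the space of continuous functions on $\Omega$ whose restriction to each cell is in $\mathbb{P}_{k+1}$ (triangular meshes) or $\mathbb{Q}_{k+1}$ (quadrangular meshes). $\mathbf{B}^{\mathrm{div}}_k$ is a space of vector fields that are polynomial in each cell, with no continuity imposed between cells; it is one of the following, given locally on each cell: (1) discontinuous Raviart–Thomas: on triangles $\mathbb{P}_k^2+(x,y)\mathbb{P}_k$; on quadrangles $\mathbb{Q}_{k+1,k}\times\mathbb{Q}_{k,k+1}$; (2) on triangles: $\mathbb{P}_k^2$; (3) on quadrangles: $\big((\mathbb{Q}_{k,k}+\mathbb{Q}_{k+1,k-1})\times(\mathbb{Q}_{k,k}+\mathbb{Q}_{k-1,k+1})\big)\oplus\mathrm{Span}\,(-x^{k+1}y^k,\;x^ky^{k+1})$.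 In all cases $\nabla^\perp$ maps $\mathbb{A}_{k+1}$ into $\mathbf{B}^{\mathrm{div}}_k$ (cellwise derivative). Adjoint curl. $\mathbb{A}_{k+1}$ and $\mathbf{B}^{\mathrm{div}}_k$ carry the $L^2(\Omega)$ scalar product, and $(\nabla^\perp)^\star:\mathbf{B}^{\mathrm{div}}_k\to\mathbb{A}_{k+1}$ is defined by $\langle(\nabla^\perp)^\star\mathbf{u}|f\rangle_{\mathbb{A}_{k+1}}=\langle\mathbf{u}|\nabla^\perp f\rangle_{\mathbf{B}^{\mathrm{div}}_k}$ for all $\mathbf{u}\in\mathbf{B}^{\mathrm{div}}_k$, $f\in\mathbb{A}_{k+1}$. The scheme discretizes $\partial_t\mathbf{u}+\nabla g=0$. It is understood that at each time $g$ is integrable on each cell and $\widetilde{\mathbf{G}}$ (single-valued on each side) is integrable on each side. "Parallel to $\mathbf{n}_S$" means $\widetilde{\mathbf{G}}=\tilde g\,\mathbf{n}_S$ on $S$ for some scalar function $\tilde g$. *)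

theory Defs
  imports "HOL-Analysis.Analysis"
begin

text \<open>
  The torus is the quotient of the plane by a period lattice, and functions on the torus are
  lattice-periodic functions on the plane. A cell of the torus is represented by one of its lifts
  to the plane, given by the cyclic list of its vertices.
\<close>

type_synonym cell = "(real^2) list"
type_synonym side = "(real^2) \<times> (real^2)"

datatype shape = Triangle | Quadrangle

fun region :: "cell \<Rightarrow> (real^2) set" where
  "region [p, q, r] = convex hull {p, q, r}"
| "region [p, q, r, s] = convex hull {p, q, r} \<union> convex hull {p, r, s}"
| "region _ = {}"

text \<open>
  Quadrangles need not be convex: every simple quadrangle has a diagonal that splits it into two
  triangles, and the vertices are listed so that this diagonal joins the first to the third one.
\<close>

fun is_cell :: "shape \<Rightarrow> cell \<Rightarrow> bool" where
  "is_cell Triangle [p, q, r] \<longleftrightarrow> \<not> collinear {p, q, r}"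
| "is_cell Quadrangle [p, q, r, s] \<longleftrightarrow>
     \<not> collinear {p, q, r} \<and> \<not> collinear {q, r, s} \<and>
     \<not> collinear {r, s, p} \<and> \<not> collinear {s, p, q} \<and>
     convex hull {p, q, r} \<inter> convex hull {p, r, s} = closed_segment p r"
| "is_cell _ _ \<longleftrightarrow> False"

definition segments :: "cell \<Rightarrow> (real^2) set set" where
  "segments C = (\<lambda>(p, q). closed_segment p q) ` set (zip C (rotate1 C))"

definition translate :: "real^2 \<Rightarrow> cell \<Rightarrow> cell" where
  "translate l C = map ((+) l) C"

text \<open>
  A side is represented by one of its lifts, given by its two end points in any order. The left
  neighbour \<open>(C, l)\<close> of a side means that the lift of the cell adjacent to the chosen lift of
  the side is \<open>C\<close> translated by the lattice vector \<open>l\<close>; similarly for the right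
  neighbour.
\<close>

record mesh =
  period1 :: "real^2"
  period2 :: "real^2"
  cells :: "cell set"
  sides :: "side set"
  normal :: "side \<Rightarrow> real^2"
  left_cell :: "side \<Rightarrow> cell \<times> (real^2)"
  right_cell :: "side \<Rightarrow> cell \<times> (real^2)"

definition lattice :: "mesh \<Rightarrow> (real^2) set" where
  "lattice M = {of_int i *\<^sub>R period1 M + of_int j *\<^sub>R period2 M | i j :: int. True}"

definition side_set :: "side \<Rightarrow> (real^2) set" where
  "side_set S = closed_segment (fst S) (snd S)"

definition outgoing :: "real^2 \<Rightarrow> cell \<Rightarrow> side \<Rightarrow> bool" where
  "outgoing n C S \<longleftrightarrow> (\<forall>x \<in> open_segment (fst S) (snd S).
     \<forall>\<^sub>F e in at_right 0. x - e *\<^sub>R n \<in> region C \<and> x + e *\<^sub>R n \<notin> region C)"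

definition ingoing :: "real^2 \<Rightarrow> cell \<Rightarrow> side \<Rightarrow> bool" where
  "ingoing n C S \<longleftrightarrow> outgoing (- n) C S"

definition conforming_mesh :: "shape \<Rightarrow> mesh \<Rightarrow> bool" where
  "conforming_mesh sh M \<longleftrightarrow>
     period1 M \<noteq> period2 M \<and> independent {period1 M, period2 M} \<and>
     finite (cells M) \<and> (\<forall>C \<in> cells M. is_cell sh C) \<and>
     (\<Union>C \<in> cells M. \<Union>l \<in> lattice M. region (translate l C)) = UNIV \<and>
     (\<forall>C \<in> cells M. \<forall>D \<in> cells M. \<forall>l \<in> lattice M. (C, 0) \<noteq> (D, l) \<longrightarrow>
        region C \<inter> region (translate l D) \<subseteq>
          (set C \<inter> set (translate l D)) \<union> \<Union> (segments C \<inter> segments (translate l D))) \<and>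
     finite (sides M) \<and>
     (\<forall>C \<in> cells M. \<forall>s \<in> segments C.
        \<exists>!S. S \<in> sides M \<and> (\<exists>l \<in> lattice M. s = (+) l ` side_set S)) \<and>
     (\<forall>S \<in> sides M.
        norm (normal M S) = 1 \<and> normal M S \<bullet> (snd S - fst S) = 0 \<and>
        (\<exists>C l. left_cell M S = (C, l) \<and> C \<in> cells M \<and> l \<in> lattice M \<and>
           side_set S \<in> segments (translate l C) \<and>
           outgoing (normal M S) (translate l C) S) \<and>
        (\<exists>C l. right_cell M S = (C, l) \<and> C \<in> cells M \<and> l \<in> lattice M \<and>
           side_set S \<in> segments (translate l C) \<and>
           ingoing (normal M S) (translate l C) S))"

text \<open>
  A cellwise function is a family indexed by the cells, so that it has one value per neighbouring
  cell on each side.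
\<close>

type_synonym 'a broken = "cell \<Rightarrow> real^2 \<Rightarrow> 'a"

definition trace :: "'a broken \<Rightarrow> cell \<times> (real^2) \<Rightarrow> real^2 \<Rightarrow> 'a" where
  "trace v Cl x = v (fst Cl) (x - snd Cl)"

definition jump :: "mesh \<Rightarrow> 'a::minus broken \<Rightarrow> side \<Rightarrow> real^2 \<Rightarrow> 'a" where
  "jump M v S x = trace v (left_cell M S) x - trace v (right_cell M S) x"

definition side_integral :: "side \<Rightarrow> (real^2 \<Rightarrow> real) \<Rightarrow> real" where
  "side_integral S h = dist (fst S) (snd S) *
     (LINT s:{0..1}|lebesgue. h (fst S + s *\<^sub>R (snd S - fst S)))"

definition side_integrable :: "side \<Rightarrow> (real^2 \<Rightarrow> 'a::euclidean_space) \<Rightarrow> bool" where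
  "side_integrable S h \<longleftrightarrow>
     set_integrable lebesgue {0..1} (\<lambda>s. h (fst S + s *\<^sub>R (snd S - fst S)))"

definition L2_inner :: "mesh \<Rightarrow> 'a::euclidean_space broken \<Rightarrow> 'a broken \<Rightarrow> real" where
  "L2_inner M v w = (\<Sum>C \<in> cells M. LINT x:region C|lebesgue. v C x \<bullet> w C x)"

definition L2_norm :: "mesh \<Rightarrow> 'a::euclidean_space broken \<Rightarrow> real" where
  "L2_norm M v = sqrt (L2_inner M v v)"

definition has_L2_time_derivative ::
  "mesh \<Rightarrow> (real \<Rightarrow> 'a::euclidean_space broken) \<Rightarrow> 'a broken \<Rightarrow> real \<Rightarrow> real set \<Rightarrow> bool" where
  "has_L2_time_derivative M u w t I \<longleftrightarrow>
     ((\<lambda>s. L2_norm M (\<lambda>C x. (u s C x - u t C x) /\<^sub>R (s - t) - w C x)) \<longlongrightarrow> 0) (at t within I)"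

definition partial :: "2 \<Rightarrow> (real^2 \<Rightarrow> real) \<Rightarrow> real^2 \<Rightarrow> real" where
  "partial i p x = frechet_derivative p (at x) (axis i 1)"

definition divergence :: "(real^2 \<Rightarrow> real^2) \<Rightarrow> real^2 \<Rightarrow> real" where
  "divergence v x = partial 1 (\<lambda>y. v y $ 1) x + partial 2 (\<lambda>y. v y $ 2) x"

definition gradperp :: "(real^2 \<Rightarrow> real) \<Rightarrow> real^2 \<Rightarrow> real^2" where
  "gradperp p x = vector [- partial 2 p x, partial 1 p x]"

definition polys :: "(nat \<times> nat) set \<Rightarrow> (real^2 \<Rightarrow> real) set" where
  "polys J = {(\<lambda>x. \<Sum>(i, j) \<in> J. c i j * (x $ 1) ^ i * (x $ 2) ^ j) | c. True}"

definition PP :: "int \<Rightarrow> (real^2 \<Rightarrow> real) set" where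
  "PP m = polys {(i, j). int i + int j \<le> m}"

definition QQ :: "int \<Rightarrow> int \<Rightarrow> (real^2 \<Rightarrow> real) set" where
  "QQ m n = polys {(i, j). int i \<le> m \<and> int j \<le> n}"

datatype div_space = RT_Triangle | RT_Quadrangle | P_Triangle | Q_Span_Quadrangle

fun shape_of :: "div_space \<Rightarrow> shape" where
  "shape_of RT_Triangle = Triangle"
| "shape_of P_Triangle = Triangle"
| "shape_of RT_Quadrangle = Quadrangle"
| "shape_of Q_Span_Quadrangle = Quadrangle"

fun local_A :: "shape \<Rightarrow> nat \<Rightarrow> (real^2 \<Rightarrow> real) set" where
  "local_A Triangle m = PP m"
| "local_A Quadrangle m = QQ m m"

fun local_B :: "div_space \<Rightarrow> nat \<Rightarrow> (real^2 \<Rightarrow> real^2) set" where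
  "local_B RT_Triangle k =
     {(\<lambda>x. vector [p x, q x] + r x *\<^sub>R x) | p q r. p \<in> PP k \<and> q \<in> PP k \<and> r \<in> PP k}"
| "local_B RT_Quadrangle k =
     {(\<lambda>x. vector [p x, q x]) | p q. p \<in> QQ (int k + 1) k \<and> q \<in> QQ k (int k + 1)}"
| "local_B P_Triangle k =
     {(\<lambda>x. vector [p x, q x]) | p q. p \<in> PP k \<and> q \<in> PP k}"
| "local_B Q_Span_Quadrangle k =
     {(\<lambda>x. vector [p x + p' x, q x + q' x]
          + c *\<^sub>R vector [- ((x $ 1) ^ (k + 1) * (x $ 2) ^ k), (x $ 1) ^ k * (x $ 2) ^ (k + 1)])
       | p p' q q' c. p \<in> QQ k k \<and> p' \<in> QQ (int k + 1) (int k - 1) \<and>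
                      q \<in> QQ k k \<and> q' \<in> QQ (int k - 1) (int k + 1)}"

definition A_space :: "mesh \<Rightarrow> shape \<Rightarrow> nat \<Rightarrow> (real^2 \<Rightarrow> real) set" where
  "A_space M sh m = {f. continuous_on UNIV f \<and>
     (\<forall>l \<in> lattice M. \<forall>x. f (x + l) = f x) \<and>
     (\<forall>C \<in> cells M. \<exists>p \<in> local_A sh m. \<forall>x \<in> region C. f x = p x)}"

definition B_space :: "mesh \<Rightarrow> div_space \<Rightarrow> nat \<Rightarrow> (real^2) broken set" where
  "B_space M B k = {v. \<forall>C \<in> cells M. v C \<in> local_B B k}"

text \<open>
  The polynomial that represents a function on a cell is determined by its values there; its
  derivative is the cellwise derivative, extended to the boundary of the cell.
\<close>

definition piece :: "shape \<Rightarrow> nat \<Rightarrow> (real^2 \<Rightarrow> real) \<Rightarrow> real broken" where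
  "piece sh m f C = (THE p. p \<in> local_A sh m \<and> (\<forall>x \<in> region C. f x = p x))"

definition broken_gradperp :: "shape \<Rightarrow> nat \<Rightarrow> (real^2 \<Rightarrow> real) \<Rightarrow> (real^2) broken" where
  "broken_gradperp sh m f C = gradperp (piece sh m f C)"

definition adjoint_gradperp ::
  "mesh \<Rightarrow> div_space \<Rightarrow> nat \<Rightarrow> (real^2) broken \<Rightarrow> real^2 \<Rightarrow> real" where
  "adjoint_gradperp M B k u = (THE w. w \<in> A_space M (shape_of B) (k + 1) \<and>
     (\<forall>f \<in> A_space M (shape_of B) (k + 1).
        L2_inner M (\<lambda>_. w) (\<lambda>_. f) = L2_inner M u (broken_gradperp (shape_of B) (k + 1) f)))"

end

theory Submission
  imports Defs
begin

text \<open>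
  The rotated gradients of the functions of \<open>A_space\<close> are test fields that the scheme does not
  see. If \<open>f\<close> is in \<open>A_space\<close>, then \<open>v = broken_gradperp f\<close> is in \<open>B_space\<close>
  (\<open>broken_gradperp_in_B_space\<close>) and is divergence free on each cell because second derivatives
  commute (\<open>divergence_gradperp_eq_0\<close>), which kills the term with \<open>g\<close>. Its normal component on a
  side is, up to a constant factor, the tangential derivative of \<open>f\<close> along that side; since \<open>f\<close> is
  continuous, both neighbouring cells give the same value, so the jump of \<open>v\<close> is tangential
  (\<open>jump_broken_gradperp_normal\<close>), which kills the flux term as soon as the flux is normal. What
  remains of the scheme is that the time derivative of \<open>u\<close> is orthogonal to \<open>v\<close>.

  By the Cauchy-Schwarz inequality, differentiability of \<open>u\<close> in the norm of \<open>L\<^sup>2\<close> makes the scalar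
  function \<open>\<langle>u | v\<rangle>\<close> differentiable (\<open>L2_inner_has_derivative\<close>), with derivative zero, so it is
  constant on the interval. The adjoint curl of \<open>u\<close> is characterized by the numbers
  \<open>\<langle>u | broken_gradperp f\<rangle>\<close> alone. Hence it is the same function at all times, and its difference
  quotients vanish identically.
\<close>

section \<open>Polynomials of two variables\<close>

lemma finite_degree_le: "finite {(i, j). int i + int j \<le> m}" "finite {(i, j). int i \<le> m \<and> int j \<le> n}"
proof -
  have "{(i, j). int i + int j \<le> m} \<subseteq> {..nat m} \<times> {..nat m}" by auto
  then show "finite {(i, j). int i + int j \<le> m}" by (rule finite_subset) simp
  have "{(i, j). int i \<le> m \<and> int j \<le> n} \<subseteq> {..nat m} \<times> {..nat n}" by auto
  then show "finite {(i, j). int i \<le> m \<and> int j \<le> n}" by (rule finite_subset) simp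
qed

lemma polys_zero: "(\<lambda>x. 0) \<in> polys J"
  unfolding polys_def by (auto intro!: exI[of _ "\<lambda>_ _. 0"])

lemma polys_add: "p \<in> polys J \<Longrightarrow> q \<in> polys J \<Longrightarrow> (\<lambda>x. p x + q x) \<in> polys J"
proof -
  assume "p \<in> polys J" "q \<in> polys J"
  then obtain c d where "p = (\<lambda>x. \<Sum>(i, j)\<in>J. c i j * (x $ 1) ^ i * (x $ 2) ^ j)"
    "q = (\<lambda>x. \<Sum>(i, j)\<in>J. d i j * (x $ 1) ^ i * (x $ 2) ^ j)"
    unfolding polys_def by blast
  then have "(\<lambda>x. p x + q x) = (\<lambda>x. \<Sum>(i, j)\<in>J. (c i j + d i j) * (x $ 1) ^ i * (x $ 2) ^ j)"
    by (simp add: sum.distrib[symmetric] case_prod_unfold algebra_simps)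
  then show ?thesis unfolding polys_def
    by (intro CollectI exI[of _ "\<lambda>i j. c i j + d i j"]) simp
qed

lemma polys_monomial:
  assumes "finite J" and "a \<noteq> 0 \<Longrightarrow> (i, j) \<in> J"
  shows "(\<lambda>x. a * (x $ 1) ^ i * (x $ 2) ^ j) \<in> polys J"
proof (cases "a = 0")
  case True
  then show ?thesis using polys_zero by simp
next
  case False
  have "(\<Sum>(i', j')\<in>J. (if i' = i \<and> j' = j then a else 0) * (x $ 1) ^ i' * (x $ 2) ^ j')
      = a * (x $ 1) ^ i * (x $ 2) ^ j" for x :: "real^2"
  proof -
    have "(\<Sum>(i', j')\<in>J. (if i' = i \<and> j' = j then a else 0) * (x $ 1) ^ i' * (x $ 2) ^ j')
        = (\<Sum>z\<in>J. if z = (i, j) then a * (x $ 1) ^ i * (x $ 2) ^ j else 0)"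
      by (rule sum.cong) (auto split: if_splits)
    then show ?thesis using assms False by (simp add: sum.delta)
  qed
  then show ?thesis unfolding polys_def
    by (intro CollectI exI[of _ "\<lambda>i' j'. if i' = i \<and> j' = j then a else 0"]) (simp add: fun_eq_iff)
qed

definition exponents :: "shape \<Rightarrow> nat \<Rightarrow> (nat \<times> nat) set" where
  "exponents sh m =
     {(i, j). case sh of Triangle \<Rightarrow> i + j \<le> m | Quadrangle \<Rightarrow> i \<le> m \<and> j \<le> m}"

lemma local_A_eq_polys: "local_A sh m = polys (exponents sh m)"
proof -
  have "exponents Triangle m = {(i, j). int i + int j \<le> int m}"
    "exponents Quadrangle m = {(i, j). int i \<le> int m \<and> int j \<le> int m}"
    unfolding exponents_def by auto
  then show ?thesis by (cases sh) (simp_all add: PP_def QQ_def)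
qed

lemma local_A_sum_of_monomials:
  assumes "p \<in> local_A sh m"
  obtains c where "p = (\<lambda>x. \<Sum>z\<in>exponents sh m. c z * (x $ 1) ^ fst z * (x $ 2) ^ snd z)"
proof -
  from assms obtain c where "p = (\<lambda>x. \<Sum>(i, j)\<in>exponents sh m. c i j * (x $ 1) ^ i * (x $ 2) ^ j)"
    unfolding local_A_eq_polys polys_def by blast
  then show thesis by (intro that[of "\<lambda>z. c (fst z) (snd z)"]) (simp add: case_prod_unfold)
qed

text \<open>
  The exponents are arbitrary functions of the summation index, and not the index itself, so that
  the derivative of such a sum is again such a sum and the rule can be applied twice.
\<close>

lemma has_derivative_monomial_sum:
  "((\<lambda>x::real^2. \<Sum>z\<in>K. a z * (x $ 1) ^ \<alpha> z * (x $ 2) ^ \<beta> z) has_derivative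
    (\<lambda>h. \<Sum>z\<in>K. a z * (real (\<alpha> z) * h $ 1 * (x $ 1) ^ (\<alpha> z - 1) * (x $ 2) ^ \<beta> z
                     + real (\<beta> z) * h $ 2 * (x $ 2) ^ (\<beta> z - 1) * (x $ 1) ^ \<alpha> z))) (at x)"
  by (auto intro!: derivative_eq_intros bounded_linear.has_derivative[OF bounded_linear_vec_nth]
      sum.cong simp: algebra_simps)

lemma partial_monomial_sum:
  "partial 1 (\<lambda>x. \<Sum>z\<in>K. a z * (x $ 1) ^ \<alpha> z * (x $ 2) ^ \<beta> z)
     = (\<lambda>x. \<Sum>z\<in>K. (a z * real (\<alpha> z)) * (x $ 1) ^ (\<alpha> z - 1) * (x $ 2) ^ \<beta> z)"
  "partial 2 (\<lambda>x. \<Sum>z\<in>K. a z * (x $ 1) ^ \<alpha> z * (x $ 2) ^ \<beta> z)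
     = (\<lambda>x. \<Sum>z\<in>K. (a z * real (\<beta> z)) * (x $ 1) ^ \<alpha> z * (x $ 2) ^ (\<beta> z - 1))"
  unfolding partial_def frechet_derivative_at[OF has_derivative_monomial_sum, symmetric]
  by (auto simp: axis_def algebra_simps intro!: sum.cong)

lemma gradperp_monomial_sum:
  "gradperp (\<lambda>x. \<Sum>z\<in>K. a z * (x $ 1) ^ \<alpha> z * (x $ 2) ^ \<beta> z)
     = (\<lambda>x. \<Sum>z\<in>K. vector [(- a z * real (\<beta> z)) * (x $ 1) ^ \<alpha> z * (x $ 2) ^ (\<beta> z - 1),
                             (a z * real (\<alpha> z)) * (x $ 1) ^ (\<alpha> z - 1) * (x $ 2) ^ \<beta> z])"
  unfolding gradperp_def partial_monomial_sum
  by (simp add: vec_eq_iff forall_2 sum_negf fun_eq_iff)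

text \<open>
  The two mixed second derivatives cancel monomial by monomial. The truncated subtraction in an
  exponent is harmless, since the factor in front of the monomial is zero whenever it truncates.
\<close>

lemma divergence_gradperp_eq_0:
  assumes "p \<in> local_A sh m"
  shows "divergence (gradperp p) x = 0"
proof -
  obtain c J where p: "p = (\<lambda>x. \<Sum>z\<in>J. c z * (x $ 1) ^ fst z * (x $ 2) ^ snd z)"
    using local_A_sum_of_monomials[OF assms] by metis
  have comps: "(\<lambda>y. gradperp p y $ 1)
      = (\<lambda>y. \<Sum>z\<in>J. (- c z * real (snd z)) * (y $ 1) ^ fst z * (y $ 2) ^ (snd z - 1))"
    "(\<lambda>y. gradperp p y $ 2)
      = (\<lambda>y. \<Sum>z\<in>J. (c z * real (fst z)) * (y $ 1) ^ (fst z - 1) * (y $ 2) ^ snd z)"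
    unfolding p gradperp_monomial_sum by (simp_all only: sum_component vector_2)
  show ?thesis
    unfolding divergence_def comps partial_monomial_sum sum.distrib[symmetric]
    by (rule sum.neutral) (simp add: mult.commute)
qed

lemma PP_zero: "(\<lambda>x. 0) \<in> PP m" and QQ_zero: "(\<lambda>x. 0) \<in> QQ m n"
  by (simp_all add: PP_def QQ_def polys_zero)

lemma PP_add: "p \<in> PP m \<Longrightarrow> q \<in> PP m \<Longrightarrow> (\<lambda>x. p x + q x) \<in> PP m"
  and QQ_add: "p \<in> QQ m n \<Longrightarrow> q \<in> QQ m n \<Longrightarrow> (\<lambda>x. p x + q x) \<in> QQ m n"
  by (simp_all add: PP_def QQ_def polys_add)

lemma PP_monomial:
  "(a \<noteq> 0 \<Longrightarrow> int i + int j \<le> m) \<Longrightarrow> (\<lambda>x. a * (x $ 1) ^ i * (x $ 2) ^ j) \<in> PP m"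
  unfolding PP_def by (rule polys_monomial[OF finite_degree_le(1)]) simp

lemma QQ_monomial:
  "(a \<noteq> 0 \<Longrightarrow> int i \<le> m \<and> int j \<le> n) \<Longrightarrow> (\<lambda>x. a * (x $ 1) ^ i * (x $ 2) ^ j) \<in> QQ m n"
  unfolding QQ_def by (rule polys_monomial[OF finite_degree_le(2)]) simp

section \<open>The rotated gradient maps into the local vector spaces\<close>

text \<open>
  Each of the four local spaces is closed under addition. It is therefore enough to place the
  rotated gradient of a single monomial.
\<close>

lemma vector_2_zero: "vector [0, 0] = (0 :: real^2)"
  by (simp add: vec_eq_iff forall_2)

lemma local_B_zero: "(\<lambda>x. 0) \<in> local_B B k"
proof (cases B)
  case RT_Triangle
  then show ?thesis
    by (auto intro!: exI[of _ "\<lambda>x. 0"] simp: PP_zero vector_2_zero)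
next
  case RT_Quadrangle
  then show ?thesis
    by (auto intro!: exI[of _ "\<lambda>x. 0"] simp: QQ_zero vector_2_zero)
next
  case P_Triangle
  then show ?thesis
    by (auto intro!: exI[of _ "\<lambda>x. 0"] simp: PP_zero vector_2_zero)
next
  case Q_Span_Quadrangle
  then show ?thesis
    by (auto intro!: exI[of _ "\<lambda>x. 0"] exI[of _ "0::real"] simp: QQ_zero vector_2_zero)
qed

lemma local_B_add:
  assumes "v \<in> local_B B k" "w \<in> local_B B k"
  shows "(\<lambda>x. v x + w x) \<in> local_B B k"
proof (cases B)
  case RT_Triangle
  from assms obtain p q r p' q' r' where
    "p \<in> PP k" "q \<in> PP k" "r \<in> PP k" "p' \<in> PP k" "q' \<in> PP k" "r' \<in> PP k"
    "v = (\<lambda>x. vector [p x, q x] + r x *\<^sub>R x)" "w = (\<lambda>x. vector [p' x, q' x] + r' x *\<^sub>R x)"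
    unfolding RT_Triangle local_B.simps by blast
  then show ?thesis unfolding RT_Triangle local_B.simps
    by (intro CollectI exI[of _ "\<lambda>x. p x + p' x"] exI[of _ "\<lambda>x. q x + q' x"] exI[of _ "\<lambda>x. r x + r' x"])
      (auto simp: PP_add vec_eq_iff forall_2 fun_eq_iff algebra_simps)
next
  case RT_Quadrangle
  from assms obtain p q p' q' where
    "p \<in> QQ (int k + 1) k" "q \<in> QQ k (int k + 1)" "p' \<in> QQ (int k + 1) k" "q' \<in> QQ k (int k + 1)"
    "v = (\<lambda>x. vector [p x, q x])" "w = (\<lambda>x. vector [p' x, q' x])"
    unfolding RT_Quadrangle local_B.simps by blast
  then show ?thesis unfolding RT_Quadrangle local_B.simps
    by (intro CollectI exI[of _ "\<lambda>x. p x + p' x"] exI[of _ "\<lambda>x. q x + q' x"])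
      (auto simp: QQ_add vec_eq_iff forall_2 fun_eq_iff)
next
  case P_Triangle
  from assms obtain p q p' q' where
    "p \<in> PP k" "q \<in> PP k" "p' \<in> PP k" "q' \<in> PP k"
    "v = (\<lambda>x. vector [p x, q x])" "w = (\<lambda>x. vector [p' x, q' x])"
    unfolding P_Triangle local_B.simps by blast
  then show ?thesis unfolding P_Triangle local_B.simps
    by (intro CollectI exI[of _ "\<lambda>x. p x + p' x"] exI[of _ "\<lambda>x. q x + q' x"])
      (auto simp: PP_add vec_eq_iff forall_2 fun_eq_iff)
next
  case Q_Span_Quadrangle
  let ?top = "\<lambda>x. vector [- ((x $ 1) ^ (k + 1) * (x $ 2) ^ k), (x $ 1) ^ k * (x $ 2) ^ (k + 1)] :: real^2"
  from assms(1) obtain p p' q q' c where v: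
    "p \<in> QQ k k" "p' \<in> QQ (int k + 1) (int k - 1)" "q \<in> QQ k k" "q' \<in> QQ (int k - 1) (int k + 1)"
    "v = (\<lambda>x. vector [p x + p' x, q x + q' x] + c *\<^sub>R ?top x)"
    unfolding Q_Span_Quadrangle local_B.simps mem_Collect_eq by (elim exE conjE)
  from assms(2) obtain r r' s s' d where w:
    "r \<in> QQ k k" "r' \<in> QQ (int k + 1) (int k - 1)" "s \<in> QQ k k" "s' \<in> QQ (int k - 1) (int k + 1)"
    "w = (\<lambda>x. vector [r x + r' x, s x + s' x] + d *\<^sub>R ?top x)"
    unfolding Q_Span_Quadrangle local_B.simps mem_Collect_eq by (elim exE conjE)
  have "v x + w x = vector [(p x + r x) + (p' x + r' x), (q x + s x) + (q' x + s' x)] + (c + d) *\<^sub>R ?top x" for x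
    unfolding v(5) w(5) scaleR_add_left
    by (simp add: vec_eq_iff forall_2)
  then show ?thesis unfolding Q_Span_Quadrangle local_B.simps
    using v(1-4) w(1-4)
    by (intro CollectI exI[of _ "\<lambda>x. p x + r x"] exI[of _ "\<lambda>x. p' x + r' x"]
        exI[of _ "\<lambda>x. q x + s x"] exI[of _ "\<lambda>x. q' x + s' x"] exI[of _ "c + d"] conjI ext QQ_add)
qed

lemma local_B_sum:
  "(\<And>z. z \<in> K \<Longrightarrow> v z \<in> local_B B k) \<Longrightarrow> (\<lambda>x. \<Sum>z\<in>K. v z x) \<in> local_B B k"
  by (induction K rule: infinite_finite_induct) (auto simp: local_B_zero local_B_add)

text \<open>
  On triangles the degree drops by one, and on Raviart-Thomas quadrangles one partial degree drops
  in each component. In the remaining space, only the monomial of highest degree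
  \<open>x\<^bsup>k+1\<^esup> y\<^bsup>k+1\<^esup>\<close> has a rotated gradient that leaves the sum of the spaces \<open>QQ\<close>; the additional
  spanning field is exactly this rotated gradient divided by \<open>k + 1\<close>.
\<close>

lemma gradperp_monomial_in_local_B:
  assumes "(i, j) \<in> exponents (shape_of B) (k + 1)"
  shows "(\<lambda>x. vector [(- a * real j) * (x $ 1) ^ i * (x $ 2) ^ (j - 1),
                       (a * real i) * (x $ 1) ^ (i - 1) * (x $ 2) ^ j]) \<in> local_B B k"
    (is "(\<lambda>x. vector [?p x, ?q x]) \<in> _")
proof (cases B)
  case RT_Triangle
  with assms have "i + j \<le> k + 1" by (simp add: exponents_def)
  then have "?p \<in> PP k" "?q \<in> PP k" by (intro PP_monomial; auto)+
  then show ?thesis unfolding RT_Triangle local_B.simps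
    by (intro CollectI exI[of _ ?p] exI[of _ ?q] exI[of _ "\<lambda>_. 0"] conjI PP_zero) simp_all
next
  case RT_Quadrangle
  with assms have "i \<le> k + 1" "j \<le> k + 1" by (simp_all add: exponents_def)
  then have "?p \<in> QQ (int k + 1) k" "?q \<in> QQ k (int k + 1)" by (intro QQ_monomial; auto)+
  then show ?thesis unfolding RT_Quadrangle local_B.simps
    by (intro CollectI exI[of _ ?p] exI[of _ ?q] conjI refl)
next
  case P_Triangle
  with assms have "i + j \<le> k + 1" by (simp add: exponents_def)
  then have "?p \<in> PP k" "?q \<in> PP k" by (intro PP_monomial; auto)+
  then show ?thesis unfolding P_Triangle local_B.simps
    by (intro CollectI exI[of _ ?p] exI[of _ ?q] conjI refl)
next
  case Q_Span_Quadrangle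
  with assms have ij: "i \<le> k + 1" "j \<le> k + 1" by (auto simp: exponents_def)
  show ?thesis
  proof (cases "i = k + 1 \<and> j = k + 1")
    case True
    then show ?thesis unfolding Q_Span_Quadrangle local_B.simps
      by (intro CollectI exI[of _ "\<lambda>_. 0"] exI[of _ "a * real (k + 1)"])
        (auto simp: QQ_zero vec_eq_iff forall_2 fun_eq_iff)
  next
    case False
    obtain p p' where p: "p \<in> QQ k k" "p' \<in> QQ (int k + 1) (int k - 1)" "?p = (\<lambda>x. p x + p' x)"
    proof (cases "i \<le> k")
      case True
      with ij have "?p \<in> QQ k k" by (intro QQ_monomial) auto
      with that[of ?p "\<lambda>_. 0"] show thesis by (simp add: QQ_zero)
    next
      case False
      with ij \<open>\<not> (i = k + 1 \<and> j = k + 1)\<close> have "?p \<in> QQ (int k + 1) (int k - 1)"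
        by (intro QQ_monomial) auto
      with that[of "\<lambda>_. 0" ?p] show thesis by (simp add: QQ_zero)
    qed
    obtain q q' where q: "q \<in> QQ k k" "q' \<in> QQ (int k - 1) (int k + 1)" "?q = (\<lambda>x. q x + q' x)"
    proof (cases "j \<le> k")
      case True
      with ij have "?q \<in> QQ k k" by (intro QQ_monomial) auto
      with that[of ?q "\<lambda>_. 0"] show thesis by (simp add: QQ_zero)
    next
      case False
      with ij \<open>\<not> (i = k + 1 \<and> j = k + 1)\<close> have "?q \<in> QQ (int k - 1) (int k + 1)"
        by (intro QQ_monomial) auto
      with that[of "\<lambda>_. 0" ?q] show thesis by (simp add: QQ_zero)
    qed
    show ?thesis unfolding Q_Span_Quadrangle local_B.simps
      by (intro CollectI exI[of _ p] exI[of _ p'] exI[of _ q] exI[of _ q'] exI[of _ 0])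
        (use p q in \<open>auto simp: fun_eq_iff\<close>)
  qed
qed

lemma gradperp_in_local_B:
  assumes "p \<in> local_A (shape_of B) (k + 1)"
  shows "gradperp p \<in> local_B B k"
proof -
  obtain c where "p = (\<lambda>x. \<Sum>z\<in>exponents (shape_of B) (k + 1). c z * (x $ 1) ^ fst z * (x $ 2) ^ snd z)"
    using local_A_sum_of_monomials[OF assms] .
  then show ?thesis
    by (simp only: gradperp_monomial_sum) (intro local_B_sum gradperp_monomial_in_local_B; simp)
qed

section \<open>Polynomials as analytic objects\<close>

lemma vector_2_eq: "(vector [a, b] :: real^2) = a *\<^sub>R axis 1 1 + b *\<^sub>R axis 2 1"
  by (simp add: vec_eq_iff forall_2 axis_def)

lemma real_polynomial_function_polys: "p \<in> polys J \<Longrightarrow> real_polynomial_function p"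
proof -
  assume "p \<in> polys J"
  then obtain c where p: "p = (\<lambda>x. \<Sum>z\<in>J. c (fst z) (snd z) * (x $ 1) ^ fst z * (x $ 2) ^ snd z)"
    unfolding polys_def by (auto simp: case_prod_unfold)
  have "real_polynomial_function (\<lambda>x::real^2. x $ i)" for i
    by (intro real_polynomial_function.intros(1) bounded_linear_vec_nth)
  then have "real_polynomial_function (\<lambda>x::real^2. \<Sum>z\<in>J. c (fst z) (snd z) * (x $ 1) ^ fst z * (x $ 2) ^ snd z)"
    by (cases "finite J") (auto intro!: real_polynomial_function_sum real_polynomial_function.intros(4)
        real_polynomial_function_power real_polynomial_function.intros(2))
  then show ?thesis by (simp add: p)
qed

lemma real_polynomial_function_local_A: "p \<in> local_A sh m \<Longrightarrow> real_polynomial_function p"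
  by (cases sh) (auto simp: PP_def QQ_def intro: real_polynomial_function_polys)

lemma polynomial_function_vector_2:
  "real_polynomial_function p \<Longrightarrow> real_polynomial_function q \<Longrightarrow>
    polynomial_function (\<lambda>x. vector [p x, q x] :: real^2)"
  unfolding vector_2_eq by (intro polynomial_function_add polynomial_function_mult)
    (auto simp: real_polynomial_function_eq)

lemma real_polynomial_function_PP: "p \<in> PP m \<Longrightarrow> real_polynomial_function p"
  and real_polynomial_function_QQ: "p \<in> QQ m n \<Longrightarrow> real_polynomial_function p"
  by (simp_all add: PP_def QQ_def real_polynomial_function_polys)

lemma polynomial_function_local_B:
  assumes "v \<in> local_B B k"
  shows "polynomial_function v"
proof (cases B)
  case RT_Triangle
  from assms obtain p q r where v: "v = (\<lambda>x. vector [p x, q x] + r x *\<^sub>R x)"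
    "p \<in> PP k" "q \<in> PP k" "r \<in> PP k"
    unfolding RT_Triangle local_B.simps by blast
  then have "polynomial_function r" by (simp add: real_polynomial_function_PP real_polynomial_function_eq[symmetric])
  with v show ?thesis
    by (auto intro!: polynomial_function_add polynomial_function_mult polynomial_function_vector_2
        real_polynomial_function_PP)
next
  case RT_Quadrangle
  with assms show ?thesis by (auto intro!: polynomial_function_vector_2 real_polynomial_function_QQ)
next
  case P_Triangle
  with assms show ?thesis by (auto intro!: polynomial_function_vector_2 real_polynomial_function_PP)
next
  case Q_Span_Quadrangle
  from assms obtain p p' q q' c where v:
    "v = (\<lambda>x. vector [p x + p' x, q x + q' x] + c *\<^sub>R
      vector [- ((x $ 1) ^ (k + 1) * (x $ 2) ^ k), (x $ 1) ^ k * (x $ 2) ^ (k + 1)])"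
    "p \<in> QQ k k" "p' \<in> QQ (int k + 1) (int k - 1)" "q \<in> QQ k k" "q' \<in> QQ (int k - 1) (int k + 1)"
    unfolding Q_Span_Quadrangle local_B.simps mem_Collect_eq by (elim exE conjE)
  show ?thesis unfolding v(1)
    by (intro polynomial_function_add polynomial_function_cmul polynomial_function_vector_2
        real_polynomial_function.intros(3) real_polynomial_function.intros(4) real_polynomial_function_minus
        real_polynomial_function_power real_polynomial_function.intros(1) bounded_linear_vec_nth
        v(2-)[THEN real_polynomial_function_QQ])
qed

text \<open>
  On the line from an interior point of \<open>T\<close> to any other point \<open>y\<close>, the polynomial becomes one of a
  single variable that vanishes on an open interval; having infinitely many zeros, it is zero at
  \<open>y\<close> too.
\<close>

lemma real_polynomial_function_zero_everywhere:
  fixes p :: "'a::euclidean_space \<Rightarrow> real"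
  assumes p: "real_polynomial_function p" and T: "interior T \<noteq> {}" and zero: "\<And>x. x \<in> T \<Longrightarrow> p x = 0"
  shows "p y = 0"
proof -
  obtain a where a: "a \<in> interior T" using T by blast
  define \<phi> where "\<phi> t = a + t *\<^sub>R (y - a)" for t
  have "polynomial_function \<phi>" unfolding \<phi>_def
    by (intro polynomial_function_add polynomial_function_mult) auto
  then have "real_polynomial_function (p \<circ> \<phi>)" using p by (rule real_polynomial_function_compose)
  then obtain c n where c: "p \<circ> \<phi> = (\<lambda>t. \<Sum>i\<le>n. c i * t ^ i)"
    unfolding real_polynomial_function_iff_sum by blast
  have "continuous_on UNIV \<phi>" unfolding \<phi>_def by (intro continuous_intros)
  then have "open (\<phi> -` interior T)" by (intro open_vimage) auto
  moreover have "0 \<in> \<phi> -` interior T" using a by (simp add: \<phi>_def)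
  ultimately have "infinite (\<phi> -` interior T)" using finite_imp_not_open by blast
  moreover have "\<phi> -` interior T \<subseteq> {t. (\<Sum>i\<le>n. c i * t ^ i) = 0}"
    using zero interior_subset by (auto simp: c[unfolded fun_eq_iff o_def, rule_format, symmetric])
  ultimately have "infinite {t. (\<Sum>i\<le>n. c i * t ^ i) = 0}" using finite_subset by blast
  then have "\<forall>k\<le>n. c k = 0" using polyfun_finite_roots by blast
  then have "(p \<circ> \<phi>) 1 = 0" unfolding c by simp
  then show ?thesis by (simp add: \<phi>_def)
qed

section \<open>Cells\<close>

lemma compact_region: "compact (region C)"
  by (cases C rule: region.cases) (auto intro!: compact_Un finite_imp_compact_convex_hull)

lemma interior_triangle_nonempty:
  fixes p :: "real^2"
  assumes "\<not> collinear {p, q, r}"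
  shows "interior (convex hull {p, q, r}) \<noteq> {}"
proof -
  have "(1/3) *\<^sub>R p + (1/3) *\<^sub>R q + (1/3) *\<^sub>R r \<in> interior (convex hull {p, q, r})"
    unfolding interior_convex_hull_3_minimal[OF assms, simplified]
    by (intro CollectI exI[of _ "1/3 :: real"] conjI) auto
  then show ?thesis by blast
qed

lemma interior_region_nonempty:
  assumes "is_cell sh C"
  shows "interior (region C) \<noteq> {}"
proof -
  from assms obtain p q r where "\<not> collinear {p, q, r}" "convex hull {p, q, r} \<subseteq> region C"
    by (cases "(sh, C)" rule: is_cell.cases) auto
  then show ?thesis using interior_triangle_nonempty interior_mono by blast
qed

lemma segment_subset_region:
  assumes "is_cell sh C" "s \<in> segments C"
  shows "s \<subseteq> region C"
proof -
  have hull: "closed_segment a b \<subseteq> convex hull T" if "a \<in> T" "b \<in> T" for a b :: "real^2" and T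
    using that by (intro closed_segment_subset_convex_hull) (auto intro: hull_inc)
  from assms(1) show ?thesis
  proof (cases "(sh, C)" rule: is_cell.cases)
    case (1 p q r)
    then show ?thesis using assms(2) hull[of _ "{p, q, r}"] by (auto simp: segments_def)
  next
    case (2 p q r s')
    then have "s \<in> {closed_segment p q, closed_segment q r, closed_segment r s', closed_segment s' p}"
      using assms(2) by (auto simp: segments_def)
    then show ?thesis using 2 hull[of p "{p, q, r}" q] hull[of q "{p, q, r}" r]
        hull[of r "{p, r, s'}" s'] hull[of s' "{p, r, s'}" p]
      by auto
  qed auto
qed

text \<open>
  The lift of a cell next to a side is a translate of the representative of that cell; a point of
  the side is moved back to a point on the boundary of the representative.
\<close>

lemma segments_translate:
  assumes "s \<in> segments (translate l C)" "x \<in> s"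
  obtains s' where "s' \<in> segments C" "x - l \<in> s'"
proof -
  have "zip (translate l C) (rotate1 (translate l C)) = map (map_prod ((+) l) ((+) l)) (zip C (rotate1 C))"
    by (simp add: translate_def rotate1_map zip_map_map map_prod_def)
  then obtain p q where pq: "(p, q) \<in> set (zip C (rotate1 C))" "s = closed_segment (l + p) (l + q)"
    using assms(1) unfolding segments_def by auto
  then have "x - l \<in> closed_segment p q"
    using assms(2) by (auto simp: closed_segment_translation)
  moreover have "closed_segment p q \<in> segments C" using pq(1) by (force simp: segments_def)
  ultimately show thesis using that by blast
qed

section \<open>The normal trace of the rotated gradient\<close>

text \<open>
  Rotating the gradient by a right angle and taking the product with \<open>n\<close> amounts to
  differentiating in the direction obtained by rotating \<open>n\<close> backwards. For a normal \<open>n\<close> of a side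
  this direction is tangential.
\<close>

lemma gradperp_inner_eq_derivative:
  assumes "p differentiable (at x)"
  shows "gradperp p x \<bullet> n = frechet_derivative p (at x) (vector [n $ 2, - n $ 1])"
proof -
  interpret linear "frechet_derivative p (at x)"
    using assms by (rule linear_frechet_derivative)
  show ?thesis
    by (simp add: gradperp_def partial_def inner_vec_def UNIV_2 vector_2_eq[of "n $ 2"] add scale diff neg)
qed

text \<open>
  The orthogonal complement of a nonzero vector in the plane is one-dimensional.
\<close>

lemma rotated_parallel_to_orthogonal:
  fixes n \<tau> :: "real^2"
  assumes "n \<bullet> \<tau> = 0" "\<tau> \<noteq> 0"
  obtains c where "vector [n $ 2, - n $ 1] = c *\<^sub>R \<tau>"
proof
  have "n $ 1 * \<tau> $ 1 + n $ 2 * \<tau> $ 2 = 0" using assms(1) by (simp add: inner_vec_def UNIV_2)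
  moreover have "(\<tau> $ 1)\<^sup>2 + (\<tau> $ 2)\<^sup>2 \<noteq> 0"
    using assms(2) by (simp add: sum_power2_eq_zero_iff vec_eq_iff forall_2)
  moreover have "n $ 2 * ((\<tau> $ 1)\<^sup>2 + (\<tau> $ 2)\<^sup>2) = (n $ 2 * \<tau> $ 1 - n $ 1 * \<tau> $ 2) * \<tau> $ 1"
    "- n $ 1 * ((\<tau> $ 1)\<^sup>2 + (\<tau> $ 2)\<^sup>2) = (n $ 2 * \<tau> $ 1 - n $ 1 * \<tau> $ 2) * \<tau> $ 2"
    using calculation(1) by algebra+
  ultimately show "vector [n $ 2, - n $ 1]
      = ((n $ 2 * \<tau> $ 1 - n $ 1 * \<tau> $ 2) / ((\<tau> $ 1)\<^sup>2 + (\<tau> $ 2)\<^sup>2)) *\<^sub>R \<tau>"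
    by (simp add: vec_eq_iff forall_2 field_simps)
qed

text \<open>
  The translations \<open>l\<close> and \<open>m\<close> bring the same side of the plane to the two cells where \<open>p\<close> and
  \<open>q\<close> live. Equality of the traces of \<open>p\<close> and \<open>q\<close> on the segment gives equality of their tangential
  derivatives. This includes the end points, since the difference of the traces is a polynomial of
  the arc parameter and vanishes even beyond them.
\<close>

lemma gradperp_normal_eq_if_traces_eq:
  assumes p: "real_polynomial_function p" and q: "real_polynomial_function q"
    and ab: "a \<noteq> b" and n: "n \<bullet> (b - a) = 0"
    and eq: "\<And>x. x \<in> closed_segment a b \<Longrightarrow> p (x - l) = q (x - m)"
    and x: "x \<in> closed_segment a b"
  shows "gradperp p (x - l) \<bullet> n = gradperp q (x - m) \<bullet> n"
proof -
  define \<tau> where "\<tau> = b - a"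
  define \<gamma> where "\<gamma> s = a + s *\<^sub>R \<tau>" for s
  have seg: "\<gamma> ` {0..1} = closed_segment a b"
    unfolding closed_segment_image_interval \<gamma>_def \<tau>_def by (simp add: algebra_simps)
  then obtain s where s: "s \<in> {0..1}" "x = \<gamma> s" using x by blast
  have line: "polynomial_function (\<lambda>s. \<gamma> s - w)" for w
    unfolding \<gamma>_def by (intro polynomial_function_diff polynomial_function_add polynomial_function_mult) auto
  have "real_polynomial_function (\<lambda>s. p (\<gamma> s - l) - q (\<gamma> s - m))"
    using real_polynomial_function_compose[OF line p] real_polynomial_function_compose[OF line q]
    by (intro real_polynomial_function_diff) (simp_all add: o_def)
  then have zero: "p (\<gamma> s - l) - q (\<gamma> s - m) = 0" for s
  proof (rule real_polynomial_function_zero_everywhere[where T = "{0..1}"])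
    fix r :: real assume "r \<in> {0..1}"
    then have "\<gamma> r \<in> closed_segment a b" using seg by blast
    then show "p (\<gamma> r - l) - q (\<gamma> r - m) = 0" using eq by simp
  qed simp
  have dp: "(p has_derivative frechet_derivative p (at y)) (at y)" for y
    using differentiable_at_real_polynomial_function[OF p] by (simp add: frechet_derivative_works[symmetric])
  have dq: "(q has_derivative frechet_derivative q (at y)) (at y)" for y
    using differentiable_at_real_polynomial_function[OF q] by (simp add: frechet_derivative_works[symmetric])
  have d\<gamma>: "((\<lambda>s. \<gamma> s - w) has_derivative (\<lambda>h. h *\<^sub>R \<tau>)) (at s)" for w
    unfolding \<gamma>_def by (auto intro!: derivative_eq_intros)
  have "((\<lambda>s. p (\<gamma> s - l) - q (\<gamma> s - m)) has_derivative
      (\<lambda>h. frechet_derivative p (at (x - l)) (h *\<^sub>R \<tau>) - frechet_derivative q (at (x - m)) (h *\<^sub>R \<tau>))) (at s)"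
    using has_derivative_diff[OF has_derivative_compose[OF d\<gamma> dp] has_derivative_compose[OF d\<gamma> dq]]
    by (simp add: s(2))
  moreover have "((\<lambda>s. p (\<gamma> s - l) - q (\<gamma> s - m)) has_derivative (\<lambda>h. 0)) (at s)"
    unfolding zero by simp
  ultimately have "(\<lambda>h. frechet_derivative p (at (x - l)) (h *\<^sub>R \<tau>)
      - frechet_derivative q (at (x - m)) (h *\<^sub>R \<tau>)) = (\<lambda>h. 0)"
    by (rule has_derivative_unique)
  then have tang: "frechet_derivative p (at (x - l)) (h *\<^sub>R \<tau>)
      = frechet_derivative q (at (x - m)) (h *\<^sub>R \<tau>)" for h
    by (metis (mono_tags, lifting) eq_iff_diff_eq_0)
  obtain c where "vector [n $ 2, - n $ 1] = c *\<^sub>R \<tau>"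
    using n ab rotated_parallel_to_orthogonal[of n \<tau>] unfolding \<tau>_def by auto
  with tang[of c] show ?thesis
    by (simp add: gradperp_inner_eq_derivative differentiable_at_real_polynomial_function p q)
qed

lemma conforming_mesh_is_cell: "conforming_mesh sh M \<Longrightarrow> C \<in> cells M \<Longrightarrow> is_cell sh C"
  unfolding conforming_mesh_def by (elim conjE) (rule bspec)

text \<open>
  The definite description in \<open>piece\<close> denotes what it should because a cell has interior points,
  so that only one polynomial can represent \<open>f\<close> there.
\<close>

lemma piece_properties:
  assumes "conforming_mesh sh M" "f \<in> A_space M sh m" "C \<in> cells M"
  shows "piece sh m f C \<in> local_A sh m" and "\<And>x. x \<in> region C \<Longrightarrow> f x = piece sh m f C x"
proof -
  have cell: "is_cell sh C" using conforming_mesh_is_cell[OF assms(1,3)] .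
  obtain p where p: "p \<in> local_A sh m" "\<forall>x \<in> region C. f x = p x"
    using assms(2,3) unfolding A_space_def by blast
  have "q = p" if q: "q \<in> local_A sh m" "\<forall>x \<in> region C. f x = q x" for q
  proof
    fix y
    have "real_polynomial_function (\<lambda>y. q y - p y)"
      using p q by (intro real_polynomial_function_diff) (rule real_polynomial_function_local_A; simp)+
    then have "q y - p y = 0"
      by (rule real_polynomial_function_zero_everywhere[OF _ interior_region_nonempty[OF cell]])
        (use p(2) q(2) in simp)
    then show "q y = p y" by simp
  qed
  with p have "\<exists>!p. p \<in> local_A sh m \<and> (\<forall>x \<in> region C. f x = p x)" by blast
  from theI'[OF this] show "piece sh m f C \<in> local_A sh m" "\<And>x. x \<in> region C \<Longrightarrow> f x = piece sh m f C x"
    unfolding piece_def by auto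
qed

lemma broken_gradperp_in_B_space:
  assumes "conforming_mesh (shape_of B) M" "f \<in> A_space M (shape_of B) (k + 1)"
  shows "broken_gradperp (shape_of B) (k + 1) f \<in> B_space M B k"
  unfolding B_space_def broken_gradperp_def
  using gradperp_in_local_B piece_properties(1)[OF assms] by blast

text \<open>
  By periodicity, the polynomials of both neighbours, translated to the chosen lift of the side,
  agree there with the continuous function \<open>f\<close>; their tangential derivatives, which are the normal
  components of the rotated gradients, therefore agree.
\<close>

lemma jump_broken_gradperp_normal:
  assumes mesh: "conforming_mesh sh M" and f: "f \<in> A_space M sh m"
    and S: "S \<in> sides M" "fst S \<noteq> snd S" and x: "x \<in> side_set S"
  shows "jump M (broken_gradperp sh m f) S x \<bullet> normal M S = 0"
proof -
  have "\<forall>S \<in> sides M.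
        norm (normal M S) = 1 \<and> normal M S \<bullet> (snd S - fst S) = 0 \<and>
        (\<exists>C l. left_cell M S = (C, l) \<and> C \<in> cells M \<and> l \<in> lattice M \<and>
           side_set S \<in> segments (translate l C) \<and>
           outgoing (normal M S) (translate l C) S) \<and>
        (\<exists>C l. right_cell M S = (C, l) \<and> C \<in> cells M \<and> l \<in> lattice M \<and>
           side_set S \<in> segments (translate l C) \<and>
           ingoing (normal M S) (translate l C) S)"
    using mesh unfolding conforming_mesh_def by (elim conjE)
  from this[rule_format, OF S(1)] obtain C l D d where n: "normal M S \<bullet> (snd S - fst S) = 0"
    and C: "left_cell M S = (C, l)" "C \<in> cells M" "l \<in> lattice M" "side_set S \<in> segments (translate l C)"
    and D: "right_cell M S = (D, d)" "D \<in> cells M" "d \<in> lattice M" "side_set S \<in> segments (translate d D)"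
    by (elim conjE exE)
  \<comment> \<open>Both neighbours have the trace of \<open>f\<close> itself on the side.\<close>
  have trace: "piece sh m f E (y - e) = f y"
    if "E \<in> cells M" "e \<in> lattice M" "side_set S \<in> segments (translate e E)" "y \<in> side_set S" for E e y
  proof -
    have "is_cell sh E" using conforming_mesh_is_cell[OF mesh that(1)] .
    then have "y - e \<in> region E"
      using segments_translate[OF that(3,4)] segment_subset_region by blast
    then have "piece sh m f E (y - e) = f (y - e)"
      using piece_properties(2)[OF mesh f that(1)] by simp
    also have "\<dots> = f (y - e + e)" using f that(2) unfolding A_space_def by (metis (mono_tags, lifting) mem_Collect_eq)
    finally show ?thesis by simp
  qed
  have "gradperp (piece sh m f C) (x - l) \<bullet> normal M S = gradperp (piece sh m f D) (x - d) \<bullet> normal M S"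
    using x trace[OF C(2-4)] trace[OF D(2-4)] S(2) n
    by (intro gradperp_normal_eq_if_traces_eq[where a = "fst S" and b = "snd S"]
        real_polynomial_function_local_A[OF piece_properties(1)[OF mesh f]] C D)
      (auto simp: side_set_def)
  then show ?thesis
    by (simp add: jump_def trace_def broken_gradperp_def C D inner_diff_left)
qed

section \<open>The broken \<open>L\<^sup>2\<close> product\<close>

text \<open>
  Continuity up to the boundary of the compact cells makes all products integrable, so that the
  bilinearity of \<open>L2_inner\<close> is available.
\<close>

definition cellwise_continuous :: "mesh \<Rightarrow> 'a::euclidean_space broken \<Rightarrow> bool" where
  "cellwise_continuous M v \<longleftrightarrow> (\<forall>C \<in> cells M. continuous_on (region C) (v C))"

lemma cellwise_continuous_B_space: "v \<in> B_space M B k \<Longrightarrow> cellwise_continuous M v"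
  unfolding cellwise_continuous_def B_space_def
  by (blast intro: continuous_on_polymonial_function polynomial_function_local_B)

lemma set_integrable_lebesgue_compact:
  fixes f :: "'a::euclidean_space \<Rightarrow> 'b::euclidean_space"
  assumes "compact K" "continuous_on K f"
  shows "set_integrable lebesgue K f"
proof -
  have "integrable lborel (\<lambda>x. indicator K x *\<^sub>R f x)"
    using assms by (rule borel_integrable_compact)
  then show ?thesis unfolding set_integrable_def
    by (subst integrable_completion) (auto dest: borel_measurable_integrable)
qed

lemma set_integrable_inner:
  assumes "cellwise_continuous M a" "cellwise_continuous M b" "C \<in> cells M"
  shows "set_integrable lebesgue (region C) (\<lambda>x. a C x \<bullet> b C x)"
  using assms unfolding cellwise_continuous_def
  by (intro set_integrable_lebesgue_compact compact_region continuous_intros) auto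

lemma L2_inner_commute: "L2_inner M a b = L2_inner M b a"
  unfolding L2_inner_def by (simp add: inner_commute)

lemma L2_inner_self_nonneg: "0 \<le> L2_inner M a a"
  unfolding L2_inner_def set_lebesgue_integral_def
  by (intro sum_nonneg Bochner_Integration.integral_nonneg) auto

lemma L2_inner_diff_left:
  assumes "cellwise_continuous M a" "cellwise_continuous M b" "cellwise_continuous M v"
  shows "L2_inner M (\<lambda>C x. a C x - b C x) v = L2_inner M a v - L2_inner M b v"
  unfolding L2_inner_def sum_subtractf[symmetric] inner_diff_left
  by (intro sum.cong refl set_integral_diff set_integrable_inner) (use assms in auto)

lemma L2_inner_scaleR_left: "L2_inner M (\<lambda>C x. r *\<^sub>R a C x) v = r * L2_inner M a v"
  unfolding L2_inner_def by (simp add: sum_distrib_left)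

lemma cellwise_continuous_diff:
  "cellwise_continuous M a \<Longrightarrow> cellwise_continuous M b \<Longrightarrow> cellwise_continuous M (\<lambda>C x. a C x - b C x)"
  unfolding cellwise_continuous_def by (auto intro!: continuous_intros)

lemma cellwise_continuous_scaleR:
  "cellwise_continuous M a \<Longrightarrow> cellwise_continuous M (\<lambda>C x. r *\<^sub>R a C x)"
  unfolding cellwise_continuous_def by (auto intro!: continuous_intros)

text \<open>
  \<open>L2_inner\<close> is only a semi-inner product on families of functions of the whole plane, whose values
  outside the cells it ignores. The proof by the discriminant of
  \<open>r \<mapsto> \<langle>a - r b | a - r b\<rangle>\<close> allows for this by treating \<open>\<langle>b | b\<rangle> = 0\<close> separately.
\<close>

lemma L2_Cauchy_Schwarz:
  assumes a: "cellwise_continuous M a" and b: "cellwise_continuous M b"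
  shows "\<bar>L2_inner M a b\<bar> \<le> L2_norm M a * L2_norm M b"
proof -
  let ?A = "L2_inner M a a" and ?B = "L2_inner M a b" and ?D = "L2_inner M b b"
  have quad: "0 \<le> ?A - 2 * r * ?B + r\<^sup>2 * ?D" for r
  proof -
    let ?w = "\<lambda>C x. a C x - r *\<^sub>R b C x"
    have w: "cellwise_continuous M ?w" by (intro cellwise_continuous_diff cellwise_continuous_scaleR a b)
    have 1: "L2_inner M ?w v = L2_inner M a v - r * L2_inner M b v" if "cellwise_continuous M v" for v
      using L2_inner_diff_left[OF a cellwise_continuous_scaleR[OF b] that] by (simp add: L2_inner_scaleR_left)
    have "0 \<le> L2_inner M ?w ?w" by (rule L2_inner_self_nonneg)
    also have "\<dots> = L2_inner M ?w a - r * L2_inner M ?w b"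
      unfolding 1[OF w] by (simp only: L2_inner_commute[of M _ ?w])
    also have "\<dots> = ?A - 2 * r * ?B + r\<^sup>2 * ?D"
      unfolding 1[OF a] 1[OF b] L2_inner_commute[of M b a] by (simp add: power2_eq_square algebra_simps)
    finally show ?thesis .
  qed
  have "?B\<^sup>2 \<le> ?A * ?D"
  proof (cases "?D = 0")
    case True
    \<comment> \<open>The quadratic is affine in \<open>r\<close>, and at this \<open>r\<close> it would take the value \<open>- 1\<close>.\<close>
    with quad[of "(?A + 1) / (2 * ?B)"] have "?B = 0" by (cases "?B = 0") (auto simp: field_simps)
    with True show ?thesis by simp
  next
    case False
    with L2_inner_self_nonneg[of M b] have D: "0 < ?D" by linarith
    have "0 \<le> ?A - ?B\<^sup>2 / ?D" using quad[of "?B / ?D"] D by (simp add: power2_eq_square field_simps)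
    with D show ?thesis by (simp add: field_simps)
  qed
  then have "sqrt (?B\<^sup>2) \<le> sqrt (?A * ?D)" by (rule real_sqrt_le_mono)
  then show ?thesis by (simp add: L2_norm_def real_sqrt_mult)
qed

text \<open>
  The error of the scalar difference quotient is the product of \<open>v\<close> with the error of the vector
  valued one, and the norm of the latter tends to zero.
\<close>

lemma L2_inner_has_derivative:
  assumes v: "cellwise_continuous M v" and w: "cellwise_continuous M w"
    and u: "\<And>s. s \<in> I \<Longrightarrow> cellwise_continuous M (u s)" and t: "t \<in> I"
    and deriv: "has_L2_time_derivative M u w t I"
  shows "((\<lambda>s. L2_inner M (u s) v) has_field_derivative L2_inner M w v) (at t within I)"
proof -
  let ?q = "\<lambda>s C x. (u s C x - u t C x) /\<^sub>R (s - t) - w C x"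
  have bound: "\<bar>(L2_inner M (u s) v - L2_inner M (u t) v) / (s - t) - L2_inner M w v\<bar>
      \<le> L2_norm M (?q s) * L2_norm M v" if "s \<in> I" for s
  proof -
    note cont = cellwise_continuous_diff[OF u[OF that] u[OF t]]
    have eq: "L2_inner M (?q s) v = (L2_inner M (u s) v - L2_inner M (u t) v) / (s - t) - L2_inner M w v"
      unfolding L2_inner_diff_left[OF cellwise_continuous_scaleR[OF cont] w v] L2_inner_scaleR_left
        L2_inner_diff_left[OF u[OF that] u[OF t] v]
      by (simp only: divide_inverse mult.commute)
    have "cellwise_continuous M (?q s)"
      by (rule cellwise_continuous_diff[OF cellwise_continuous_scaleR[OF cont] w])
    from L2_Cauchy_Schwarz[OF this v] show ?thesis unfolding eq .
  qed
  have "((\<lambda>s. L2_norm M (?q s) * L2_norm M v) \<longlongrightarrow> 0) (at t within I)"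
    using tendsto_mult_left_zero[OF deriv[unfolded has_L2_time_derivative_def]] .
  then have "((\<lambda>s. (L2_inner M (u s) v - L2_inner M (u t) v) / (s - t) - L2_inner M w v) \<longlongrightarrow> 0) (at t within I)"
    by (rule Lim_null_comparison[rotated]) (use bound in \<open>auto simp: eventually_at_filter\<close>)
  then show ?thesis unfolding has_field_derivative_iff by (rule LIM_zero_cancel)
qed

section \<open>Conservation of the adjoint curl\<close>

theorem proposition2:
  fixes M :: mesh and B :: div_space and k :: nat and I :: "real set"
    and u u' :: "real \<Rightarrow> (real^2) broken"
    and g :: "real \<Rightarrow> real broken"
    and G :: "real \<Rightarrow> side \<Rightarrow> real^2 \<Rightarrow> real^2"
  assumes mesh: "conforming_mesh (shape_of B) M"
    and interval: "is_interval I"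
    and u_in: "\<And>t. t \<in> I \<Longrightarrow> u t \<in> B_space M B k"
    and u'_in: "\<And>t. t \<in> I \<Longrightarrow> u' t \<in> B_space M B k"
    and u'_deriv: "\<And>t. t \<in> I \<Longrightarrow> has_L2_time_derivative M u (u' t) t I"
    and g_int: "\<And>t C. t \<in> I \<Longrightarrow> C \<in> cells M \<Longrightarrow> set_integrable lebesgue (region C) (g t C)"
    and G_int: "\<And>t S. t \<in> I \<Longrightarrow> S \<in> sides M \<Longrightarrow> side_integrable S (G t S)"
    and scheme: "\<And>t v. t \<in> I \<Longrightarrow> v \<in> B_space M B k \<Longrightarrow>
          (\<Sum>C \<in> cells M. LINT x:region C|lebesgue. v C x \<bullet> u' t C x)
        - (\<Sum>C \<in> cells M. LINT x:region C|lebesgue. g t C x * divergence (v C) x)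
        + (\<Sum>S \<in> sides M. side_integral S (\<lambda>x. jump M v S x \<bullet> G t S x)) = 0"
    and parallel: "\<And>t S. t \<in> I \<Longrightarrow> S \<in> sides M \<Longrightarrow>
          \<exists>gt :: real^2 \<Rightarrow> real. \<forall>x \<in> side_set S. G t S x = gt x *\<^sub>R normal M S"
  shows "\<forall>t \<in> I. has_L2_time_derivative M (\<lambda>s _. adjoint_gradperp M B k (u s)) (\<lambda>_ _. 0) t I"
proof
  fix t assume t: "t \<in> I"
  let ?A = "A_space M (shape_of B) (k + 1)"
  let ?grad = "broken_gradperp (shape_of B) (k + 1)"
  have orthogonal: "L2_inner M (u' s) (?grad f) = 0" if f: "f \<in> ?A" and s: "s \<in> I" for f s
  proof -
    have "(LINT x:region C|lebesgue. g s C x * divergence (?grad f C) x) = 0" if "C \<in> cells M" for C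
      using divergence_gradperp_eq_0[OF piece_properties(1)[OF mesh f that]]
      by (simp add: broken_gradperp_def)
    moreover have "side_integral S (\<lambda>x. jump M (?grad f) S x \<bullet> G s S x) = 0" if S: "S \<in> sides M" for S
    \<comment> \<open>A side whose end points coincide has no tangent, but its integral carries the factor zero.\<close>
    proof (cases "fst S = snd S")
      case True
      then show ?thesis by (simp add: side_integral_def)
    next
      case False
      obtain gt where gt: "\<And>x. x \<in> side_set S \<Longrightarrow> G s S x = gt x *\<^sub>R normal M S"
        using parallel[OF s S] by blast
      have "jump M (?grad f) S x \<bullet> G s S x = 0" if "x \<in> side_set S" for x
        using jump_broken_gradperp_normal[OF mesh f S False that] gt[OF that] by simp
      moreover have "fst S + r *\<^sub>R (snd S - fst S) \<in> side_set S" if "r \<in> {0..1}" for r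
        unfolding side_set_def closed_segment_def
        using that by (intro CollectI exI[of _ r]) (simp add: algebra_simps)
      ultimately have "(LINT r:{0..1}|lebesgue. jump M (?grad f) S (fst S + r *\<^sub>R (snd S - fst S))
          \<bullet> G s S (fst S + r *\<^sub>R (snd S - fst S))) = (LINT r:{0..1::real}|lebesgue. 0)"
        by (intro set_lebesgue_integral_cong) auto
      then show ?thesis by (simp add: side_integral_def)
    qed
    ultimately have "L2_inner M (?grad f) (u' s) = 0"
      using scheme[OF s broken_gradperp_in_B_space[OF mesh f]] by (simp add: L2_inner_def)
    then show ?thesis by (simp add: L2_inner_commute)
  qed
  have "L2_inner M (u s) (?grad f) = L2_inner M (u t) (?grad f)" if f: "f \<in> ?A" and s: "s \<in> I" for f s
  proof -
    have "\<exists>c. \<forall>s\<in>I. L2_inner M (u s) (?grad f) = c"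
    proof (rule has_field_derivative_zero_constant)
      show "convex I" using interval by (simp add: is_interval_convex)
      fix r assume r: "r \<in> I"
      show "((\<lambda>s. L2_inner M (u s) (?grad f)) has_field_derivative 0) (at r within I)"
        using L2_inner_has_derivative[OF _ _ _ r u'_deriv[OF r], of "?grad f"]
          cellwise_continuous_B_space[OF broken_gradperp_in_B_space[OF mesh f]]
          cellwise_continuous_B_space[OF u'_in[OF r]] cellwise_continuous_B_space[OF u_in]
          orthogonal[OF f r]
        by simp
    qed
    with s t show ?thesis by auto
  qed
  \<comment> \<open>At times \<open>s\<close> and \<open>t\<close> the adjoint is given by definite descriptions with the same body.\<close>
  then have const: "adjoint_gradperp M B k (u s) = adjoint_gradperp M B k (u t)" if "s \<in> I" for s
    unfolding adjoint_gradperp_def using that by (metis (no_types, lifting))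
  have "L2_norm M (\<lambda>C x. (adjoint_gradperp M B k (u s) x - adjoint_gradperp M B k (u t) x) /\<^sub>R (s - t) - 0) = 0"
    if "s \<in> I" for s
    using const[OF that] by (simp add: L2_norm_def L2_inner_def)
  then show "has_L2_time_derivative M (\<lambda>s _. adjoint_gradperp M B k (u s)) (\<lambda>_ _. 0) t I"
    unfolding has_L2_time_derivative_def
    by (intro tendsto_eventually) (auto simp: eventually_at_filter)
qed

end
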